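(* Let $q(x,t)>0$ be a continuous function (with respect to $x$ and $t$) for $x\in(x_l,x_r)\subset\mathbb{R}$, $t\in[0,T]$. Let $m\ge 1$, let $x_1,\dots,x_m\in(x_l,x_r)$, and for $0\le k\le N$ define the diagonal matrix $$\mathbf{Q}^{(k)}:=\mathrm{diag}\big(q(x_1,t_k),q(x_2,t_k),\dots,q(x_m,t_k)\big).$$ Let $\mathbf{z}^k=(z_1^k,\dots,z_m^k)^T\in\mathbb{R}^m$ $(0\le k\le N)$ be real vectors and put $\mathbf{z}^{n-\theta}:=(1-\theta)\mathbf{z}^n+\theta\mathbf{z}^{n-1}$. Then for every $1\le n\le N$ $$(\mathbf{z}^{n-\theta})^T\mathbf{Q}^{(n)}(\mathcal{D}_\tau^\beta\mathbf{z})^{n-\theta}\ \ge\ \frac12\sum_{k=1}^nA_{n-k}^{(n)}\nabla_\tau\big[(\mathbf{z}^k)^T\mathbf{Q}^{(n)}\mathbf{z}^k\big],$$ where in the sum $\nabla_\tau\big[(\mathbf{z}^k)^T\mathbf{Q}^{(n)}\mathbf{z}^k\big]=(\mathbf{z}^k)^T\mathbf{Q}^{(n)}\mathbf{z}^k-(\mathbf{z}^{k-1})^T\mathbf{Q}^{(n)}\mathbf{z}^{k-1}$. Moreover, if $q(x,t)$ is non-increasing with respect to $t$ for every fixed $x$, then for every $1\le n\le N$ $$(\mathbf{z}^{n-\theta})^T\mathbf{Q}^{(n)}(\mathcal{D}_\tau^\beta\mathbf{z})^{n-\theta}\ \ge\ \frac12\sum_{k=1}^nA_{n-k}^{(n)}\nabla_\tau\big[(\mathbf{z}^k)^T\mathbf{Q}^{(k)}\mathbf{z}^k\big],$$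 where $\nabla_\tau\big[(\mathbf{z}^k)^T\mathbf{Q}^{(k)}\mathbf{z}^k\big]=(\mathbf{z}^k)^T\mathbf{Q}^{(k)}\mathbf{z}^k-(\mathbf{z}^{k-1})^T\mathbf{Q}^{(k-1)}\mathbf{z}^{k-1}$.
   Context: Let $\beta\in(0,1)$, $\theta:=\beta/2$, $T>0$, and let $0=t_0<t_1<\cdots<t_N=T$ be a (possibly nonuniform) time mesh with steps $\tau_k:=t_k-t_{k-1}$, step ratios $\rho_k:=\tau_k/\tau_{k+1}$, and $\max_k\rho_k\le 7/4$. Put $t_{n-\theta}:=(1-\theta)t_n+\theta t_{n-1}$, $t_{k-\frac12}:=(t_{k-1}+t_k)/2$, and $\omega_{\mu}(t):=t^{\mu-1}/\Gamma(\mu)$. Alikhanov coefficients: define $$a_{n-k}^{(n)}:=\frac1{\tau_k}\int_{t_{k-1}}^{\min\{t_k,t_{n-\theta}\}}\omega_{1-\beta}(t_{n-\theta}-s)\,ds\quad(1\le k\le n),$$ $$b_{n-k}^{(n)}:=\frac2{\tau_k(\tau_k+\tau_{k+1})}\int_{t_{k-1}}^{t_k}\omega_{1-\beta}(t_{n-\theta}-s)(s-t_{k-\frac12})\,ds\quad(1\le k\le n-1).$$ Set $A_0^{(1)}:=a_0^{(1)}$ and, for $n\ge2$, $A_0^{(n)}:=a_0^{(n)}+\rho_{n-1}b_1^{(n)}$; $A_{n-k}^{(n)}:=a_{n-k}^{(n)}+\rho_{k-1}b_{n-k+1}^{(n)}-b_{n-k}^{(n)}$ for $2\le k\le n-1$;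 $A_{n-1}^{(n)}:=a_{n-1}^{(n)}-b_{n-1}^{(n)}$. Discrete Caputo derivative (Alikhanov formula): for a sequence $g^0,\dots,g^N$ (scalars or vectors), $\nabla_\tau g^k:=g^k-g^{k-1}$ and $(\mathcal{D}_\tau^\beta g)^{n-\theta}:=\sum_{k=1}^nA_{n-k}^{(n)}\nabla_\tau g^k$. *)

theory Defs
  imports "HOL-Analysis.Analysis"
begin

definition omega :: "real \<Rightarrow> real \<Rightarrow> real" where
  "omega \<mu> s = s powr (\<mu> - 1) / Gamma \<mu>"

definition step :: "(nat \<Rightarrow> real) \<Rightarrow> nat \<Rightarrow> real" where
  "step t k = t k - t (k - 1)"

definition step_ratio :: "(nat \<Rightarrow> real) \<Rightarrow> nat \<Rightarrow> real" where
  "step_ratio t k = step t k / step t (k + 1)"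

text \<open>The value at the offset point \<open>n - \<theta>\<close>. It serves for the mesh itself
  (\<open>offset \<theta> t n\<close> is the time \<open>t\<close> at index \<open>n - \<theta>\<close>) as well as for sequences of vectors.\<close>

definition offset :: "real \<Rightarrow> (nat \<Rightarrow> 'a::real_vector) \<Rightarrow> nat \<Rightarrow> 'a" where
  "offset \<theta> g n = (1 - \<theta>) *\<^sub>R g n + \<theta> *\<^sub>R g (n - 1)"

definition midpoint_time :: "(nat \<Rightarrow> real) \<Rightarrow> nat \<Rightarrow> real" where
  "midpoint_time t k = (t (k - 1) + t k) / 2"

text \<open>In \<open>alikhanov_a\<close>, \<open>alikhanov_b\<close> and \<open>alikhanov_A\<close> the argument \<open>j\<close> is the lower index
  \<open>n - k\<close> of the coefficient and \<open>n\<close> is its upper index, so the time interval involved is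
  the one with number \<open>k = n - j\<close>. The coefficients are meaningful for \<open>j < n\<close>
  (for \<open>alikhanov_b\<close>, for \<open>0 < j < n\<close>). The integrand of \<open>alikhanov_a\<close> for \<open>j = 0\<close> has an
  integrable singularity at the right endpoint, where \<open>omega\<close> takes the value \<open>0\<close>.\<close>

definition alikhanov_a :: "real \<Rightarrow> (nat \<Rightarrow> real) \<Rightarrow> nat \<Rightarrow> nat \<Rightarrow> real" where
  "alikhanov_a \<beta> t n j =
    (let k = n - j; tn = offset (\<beta> / 2) t n in
      1 / step t k *
      integral {t (k - 1) .. min (t k) tn} (\<lambda>s. omega (1 - \<beta>) (tn - s)))"

definition alikhanov_b :: "real \<Rightarrow> (nat \<Rightarrow> real) \<Rightarrow> nat \<Rightarrow> nat \<Rightarrow> real" where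
  "alikhanov_b \<beta> t n j =
    (let k = n - j; tn = offset (\<beta> / 2) t n in
      2 / (step t k * (step t k + step t (k + 1))) *
      integral {t (k - 1) .. t k} (\<lambda>s. omega (1 - \<beta>) (tn - s) * (s - midpoint_time t k)))"

definition alikhanov_A :: "real \<Rightarrow> (nat \<Rightarrow> real) \<Rightarrow> nat \<Rightarrow> nat \<Rightarrow> real" where
  "alikhanov_A \<beta> t n j =
    (if n = 1 then alikhanov_a \<beta> t 1 0
     else if j = 0 then alikhanov_a \<beta> t n 0 + step_ratio t (n - 1) * alikhanov_b \<beta> t n 1
     else if j = n - 1 then alikhanov_a \<beta> t n (n - 1) - alikhanov_b \<beta> t n (n - 1)
     else alikhanov_a \<beta> t n j + step_ratio t (n - j - 1) * alikhanov_b \<beta> t n (j + 1)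
            - alikhanov_b \<beta> t n j)"

definition nabla :: "(nat \<Rightarrow> 'a::real_vector) \<Rightarrow> nat \<Rightarrow> 'a" where
  "nabla g k = g k - g (k - 1)"

definition discrete_caputo ::
    "real \<Rightarrow> (nat \<Rightarrow> real) \<Rightarrow> (nat \<Rightarrow> 'a::real_vector) \<Rightarrow> nat \<Rightarrow> 'a" where
  "discrete_caputo \<beta> t g n = (\<Sum>k=1..n. alikhanov_A \<beta> t n (n - k) *\<^sub>R nabla g k)"

definition diag :: "real ^ 'm \<Rightarrow> real ^ 'm ^ 'm" where
  "diag d = (\<chi> i j. if i = j then d $ i else 0)"

definition Qmat ::
    "(real \<Rightarrow> real \<Rightarrow> real) \<Rightarrow> real ^ 'm \<Rightarrow> (nat \<Rightarrow> real) \<Rightarrow> nat \<Rightarrow> real ^ 'm ^ 'm" where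
  "Qmat q x t k = diag (\<chi> i. q (x $ i) (t k))"

end

theory Submission
  imports Defs
begin

text \<open>Let \<open>K s\<close> be the kernel of the Caputo derivative seen from the offset time at index \<open>n\<close>; it is
  nonnegative, increasing and convex in the past time \<open>s\<close>. Write \<open>A k\<close> for the coefficient with
  lower index \<open>n - k\<close>. For \<open>k < n\<close> it is the mean of \<open>K\<close> over the interval number \<open>k\<close>, corrected
  by the scaled centred first moments \<open>b\<close> of \<open>K\<close> over this interval and the previous one, and it
  lies between the values of the kernel at the ends of the interval,

  \<open>K (t (k - 1)) \<le> A k \<le> K (t k)\<close>

  (\<open>kernel_le_alikhanov_A\<close>, \<open>alikhanov_A_le_kernel\<close>). The lower bound needs only that \<open>K\<close> is
  increasing. For the upper bound, both the correction by the previous interval and the gap between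
  \<open>K (t k)\<close> and the mean are measured by the derivative of \<open>K\<close> at \<open>t (k - 1)\<close>, and the gap wins
  because the step ratios are at most \<open>7 / 4\<close>. For \<open>k = n\<close> the singular integral is explicit and
  gives \<open>(1 - \<beta>) * A n \<ge> (1 - \<theta>) * K (t (n - 1))\<close> (\<open>kernel_le_alikhanov_A_0\<close>). Hence the
  \<open>A k\<close> are nonnegative and increase with \<open>k\<close>, and, as \<open>\<beta> = 2 * \<theta>\<close>,
  \<open>(1 - 2 * \<theta>) * A n \<ge> (1 - \<theta>)^2 * A (n - 1)\<close>.

  As the matrices are diagonal, it suffices to treat scalar sequences \<open>v\<close> with a weight \<open>q k\<close> at
  time \<open>t k\<close>. Let \<open>w\<close> be the offset value of \<open>v\<close> and \<open>u k = (w - v k)^2\<close>. Then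

  \<open>(v k - v (k - 1)) * w - ((v k)^2 - (v (k - 1))^2) / 2 = (u (k - 1) - u k) / 2\<close>,

  so that the first inequality is the nonnegativity of \<open>\<Sum>k. A k * (u (k - 1) - u k)\<close>, which follows
  by summation by parts (\<open>offset_convexity_sum_nonneg\<close>). Passing from the weight \<open>q n\<close> to the
  weights \<open>q k\<close> decreases the right-hand side, again by summation by parts, now with
  \<open>(q k - q n) * (v k)^2 \<ge> 0\<close> in the role of \<open>u k\<close> (\<open>abel_sum_lower_bound\<close>).\<close>

section \<open>Integrals against a monotone function\<close>

lemma integrable_times_centred:
  fixes f :: "real \<Rightarrow> real"
  assumes "continuous_on {a..b} f"
  shows "(\<lambda>s. f s * (s - m)) integrable_on {a..b}"
  by (intro integrable_continuous_real continuous_intros assms)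

lemma has_integral_centred:
  fixes a b :: real
  assumes "a \<le> b"
  shows "((\<lambda>s. s - (a + b) / 2) has_integral 0) {a..b}"
proof -
  have "((\<lambda>s. s - (a + b) / 2) has_integral
      ((b - (a + b) / 2)\<^sup>2 / 2 - (a - (a + b) / 2)\<^sup>2 / 2)) {a..b}"
    by (rule fundamental_theorem_of_calculus[OF assms])
       (auto intro!: derivative_eq_intros simp flip: has_real_derivative_iff_has_vector_derivative)
  then show ?thesis
    by (simp add: power2_eq_square field_simps)
qed

lemma has_integral_centred_square:
  fixes a b :: real
  assumes "a \<le> b"
  shows "((\<lambda>s. (s - (a + b) / 2)\<^sup>2) has_integral (b - a) ^ 3 / 12) {a..b}"
proof -
  have "((\<lambda>s. (s - (a + b) / 2)\<^sup>2) has_integral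
      ((b - (a + b) / 2) ^ 3 / 3 - (a - (a + b) / 2) ^ 3 / 3)) {a..b}"
    by (rule fundamental_theorem_of_calculus[OF assms])
       (auto intro!: derivative_eq_intros simp flip: has_real_derivative_iff_has_vector_derivative)
  moreover have "(b - (a + b) / 2) ^ 3 / 3 - (a - (a + b) / 2) ^ 3 / 3 = (b - a) ^ 3 / 12"
    by (simp add: power3_eq_cube field_simps)
  ultimately show ?thesis by simp
qed

lemma centred_moment_nonneg:
  fixes f :: "real \<Rightarrow> real"
  assumes "a \<le> b" and cont: "continuous_on {a..b} f" and mono: "mono_on {a..b} f"
  shows "0 \<le> integral {a..b} (\<lambda>s. f s * (s - (a + b) / 2))"
proof -
  let ?m = "(a + b) / 2"
  have m: "?m \<in> {a..b}" using \<open>a \<le> b\<close> by auto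
  have c: "((\<lambda>s. f ?m * (s - ?m)) has_integral 0) {a..b}"
    using has_integral_mult_right[OF has_integral_centred[OF \<open>a \<le> b\<close>], of "f ?m"] by simp
  show ?thesis
  proof (rule has_integral_le[OF c integrable_integral[OF integrable_times_centred[OF cont]]])
    fix s assume s: "s \<in> {a..b}"
    show "f ?m * (s - ?m) \<le> f s * (s - ?m)"
    proof (cases "?m \<le> s")
      case True
      then show ?thesis using mono_onD[OF mono m s] by (intro mult_right_mono) auto
    next
      case False
      then show ?thesis using mono_onD[OF mono s m] by (intro mult_right_mono_neg) auto
    qed
  qed
qed

text \<open>The hypothesis says that \<open>f s - D * s\<close> is nonincreasing, so that its centred moment is at most
  zero; the bound is the centred moment of \<open>D * s\<close>.\<close>

lemma centred_moment_le:
  fixes f :: "real \<Rightarrow> real"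
  assumes "a \<le> b" and cont: "continuous_on {a..b} f"
    and slope: "\<And>r s. a \<le> r \<Longrightarrow> r \<le> s \<Longrightarrow> s \<le> b \<Longrightarrow> f s - f r \<le> D * (s - r)"
  shows "integral {a..b} (\<lambda>s. f s * (s - (a + b) / 2)) \<le> D * (b - a) ^ 3 / 12"
proof -
  let ?m = "(a + b) / 2"
  have c: "((\<lambda>s. f ?m * (s - ?m) + D * (s - ?m)\<^sup>2) has_integral D * (b - a) ^ 3 / 12) {a..b}"
    using has_integral_add[OF has_integral_mult_right[OF has_integral_centred[OF \<open>a \<le> b\<close>], of "f ?m"]
        has_integral_mult_right[OF has_integral_centred_square[OF \<open>a \<le> b\<close>], of D]]
    by simp
  show ?thesis
  proof (rule has_integral_le[OF integrable_integral[OF integrable_times_centred[OF cont]] c])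
    fix s assume s: "s \<in> {a..b}"
    have "0 \<le> (f ?m + D * (s - ?m) - f s) * (s - ?m)"
    proof (cases "?m \<le> s")
      case True
      then show ?thesis using slope[of ?m s] s by (intro mult_nonneg_nonneg) auto
    next
      case False
      then show ?thesis using slope[of s ?m] s
        by (intro mult_nonpos_nonpos) (auto simp: right_diff_distrib)
    qed
    moreover have "(f ?m + D * (s - ?m) - f s) * (s - ?m)
        = (f ?m * (s - ?m) + D * (s - ?m)\<^sup>2) - f s * (s - ?m)"
      by (simp only: power2_eq_square left_diff_distrib distrib_right mult.assoc)
    ultimately show "f s * (s - ?m) \<le> f ?m * (s - ?m) + D * (s - ?m)\<^sup>2"
      by linarith
  qed
qed

text \<open>The right-hand side is the integral of \<open>f\<close> against a weight \<open>1 / (b - a) - const * (s - m)\<close>, with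
  \<open>m\<close> the midpoint, of total mass \<open>1\<close>; the weight is nonnegative because \<open>h \<ge> 0\<close>.\<close>

lemma mean_minus_centred_moment_ge:
  fixes f :: "real \<Rightarrow> real"
  assumes "a < b" "0 \<le> h" and cont: "continuous_on {a..b} f" and mono: "mono_on {a..b} f"
  shows "f a \<le> 1 / (b - a) * integral {a..b} f
      - 2 / ((b - a) * (b - a + h)) * integral {a..b} (\<lambda>s. f s * (s - (a + b) / 2))"
proof -
  let ?m = "(a + b) / 2"
  let ?w = "\<lambda>s. 1 / (b - a) - 2 / ((b - a) * (b - a + h)) * (s - ?m)"
  have ab: "a \<le> b" using \<open>a < b\<close> by simp
  have one: "((\<lambda>s. f a / (b - a)) has_integral f a) {a..b}"
    using has_integral_const_real[of "f a / (b - a)" a b] \<open>a < b\<close> by simp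
  have c: "((\<lambda>s. f a * ?w s) has_integral f a) {a..b}"
    using has_integral_diff[OF one has_integral_mult_right[OF has_integral_centred[OF ab],
        of "f a * (2 / ((b - a) * (b - a + h)))"]]
    by (simp add: right_diff_distrib mult.assoc)
  have int: "((\<lambda>s. f s * ?w s) has_integral 1 / (b - a) * integral {a..b} f
      - 2 / ((b - a) * (b - a + h)) * integral {a..b} (\<lambda>s. f s * (s - ?m))) {a..b}"
    using has_integral_diff[OF
        has_integral_mult_right[OF integrable_integral[OF integrable_continuous_real[OF cont]],
          of "1 / (b - a)"]
        has_integral_mult_right[OF integrable_integral[OF integrable_times_centred[OF cont]],
          of "2 / ((b - a) * (b - a + h))" ?m]]
    by (simp add: algebra_simps)
  show ?thesis
  proof (rule has_integral_le[OF c int])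
    fix s assume s: "s \<in> {a..b}"
    have "2 / ((b - a) * (b - a + h)) * (s - ?m) \<le> 2 / ((b - a) * (b - a + h)) * ((b - a + h) / 2)"
    proof (rule mult_left_mono)
      show "s - ?m \<le> (b - a + h) / 2" using s assms(2) by (simp add: field_simps)
    qed (use assms(1,2) in simp)
    also have "\<dots> = 1 / (b - a)" using assms(1,2) by (simp add: divide_simps)
    finally have "0 \<le> ?w s" by simp
    moreover have "f a \<le> f s" using mono_onD[OF mono, of a s] s by auto
    ultimately show "f a * ?w s \<le> f s * ?w s" by (rule mult_right_mono[rotated])
  qed
qed

lemma mean_le_right_value:
  fixes f :: "real \<Rightarrow> real"
  assumes "a < b" and cont: "continuous_on {a..b} f"
    and slope: "\<And>s. a \<le> s \<Longrightarrow> s \<le> b \<Longrightarrow> D * (b - s) \<le> f b - f s"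
  shows "1 / (b - a) * integral {a..b} f \<le> f b - D * (b - a) / 2"
proof -
  let ?m = "(a + b) / 2"
  have ab: "a \<le> b" using \<open>a < b\<close> by simp
  have one: "((\<lambda>s. f b - D * (b - ?m)) has_integral (b - a) * (f b - D * (b - ?m))) {a..b}"
    using has_integral_const_real[of "f b - D * (b - ?m)" a b] \<open>a < b\<close> by simp
  have "((\<lambda>s. (f b - D * (b - ?m)) + D * (s - ?m)) has_integral
      (b - a) * (f b - D * (b - ?m))) {a..b}"
    using has_integral_add[OF one has_integral_mult_right[OF has_integral_centred[OF ab], of D]]
    by simp
  then have "integral {a..b} f \<le> (b - a) * (f b - D * (b - ?m))"
  proof (rule has_integral_le[OF integrable_integral[OF integrable_continuous_real[OF cont]]])
    fix s assume "s \<in> {a..b}"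
    then show "f s \<le> (f b - D * (b - ?m)) + D * (s - ?m)"
      using slope[of s] by (simp add: algebra_simps)
  qed
  then have "integral {a..b} f / (b - a) \<le> f b - D * (b - ?m)"
    using \<open>a < b\<close> by (simp add: divide_le_eq mult.commute)
  moreover have "b - ?m = (b - a) / 2" by (simp add: field_simps)
  ultimately show ?thesis by simp
qed

section \<open>The memory kernel\<close>

text \<open>The kernel of the Caputo derivative at time \<open>c\<close>, as a function of the past time \<open>s < c\<close>,
  and its derivative in \<open>s\<close>.\<close>

definition memory_kernel :: "real \<Rightarrow> real \<Rightarrow> real \<Rightarrow> real" where
  "memory_kernel \<beta> c s = omega (1 - \<beta>) (c - s)"

definition memory_kernel_slope :: "real \<Rightarrow> real \<Rightarrow> real \<Rightarrow> real" where
  "memory_kernel_slope \<beta> c s = \<beta> * (c - s) powr (- \<beta> - 1) / Gamma (1 - \<beta>)"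

lemma Gamma_real_nonzero: "0 < x \<Longrightarrow> Gamma (x :: real) \<noteq> 0"
  by (metis Gamma_real_pos less_irrefl)

lemma memory_kernel_nonneg: "\<beta> < 1 \<Longrightarrow> 0 \<le> memory_kernel \<beta> c s"
  by (simp add: memory_kernel_def omega_def Gamma_real_pos less_imp_le)

lemma memory_kernel_slope_nonneg: "0 < \<beta> \<Longrightarrow> \<beta> < 1 \<Longrightarrow> 0 \<le> memory_kernel_slope \<beta> c s"
  by (simp add: memory_kernel_slope_def Gamma_real_pos less_imp_le)

lemma memory_kernel_has_derivative:
  assumes "\<beta> < 1" "s < c"
  shows "(memory_kernel \<beta> c has_real_derivative memory_kernel_slope \<beta> c s) (at s)"
proof -
  have "Gamma (1 - \<beta>) \<noteq> 0" using assms by (simp add: Gamma_real_nonzero)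
  then have "((\<lambda>s. (c - s) powr (- \<beta>) / Gamma (1 - \<beta>)) has_real_derivative
      memory_kernel_slope \<beta> c s) (at s)"
    unfolding memory_kernel_slope_def using assms
    by (auto intro!: derivative_eq_intros)
  then show ?thesis by (simp add: memory_kernel_def[abs_def] omega_def)
qed

lemma memory_kernel_slope_mono:
  assumes "0 < \<beta>" "\<beta> < 1" "r \<le> s" "s < c"
  shows "memory_kernel_slope \<beta> c r \<le> memory_kernel_slope \<beta> c s"
  unfolding memory_kernel_slope_def using assms
  by (intro divide_right_mono mult_left_mono powr_mono2')
     (auto simp: Gamma_real_pos less_imp_le)

lemma memory_kernel_continuous_on:
  assumes "\<beta> < 1" "b < c"
  shows "continuous_on {a..b} (memory_kernel \<beta> c)"
proof (rule continuous_at_imp_continuous_on, intro ballI)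
  fix s assume "s \<in> {a..b}"
  then show "isCont (memory_kernel \<beta> c) s"
    using assms by (intro DERIV_isCont[OF memory_kernel_has_derivative]) auto
qed

lemma memory_kernel_increment:
  assumes "0 < \<beta>" "\<beta> < 1" "r \<le> s" "s < c"
  shows "memory_kernel_slope \<beta> c r * (s - r) \<le> memory_kernel \<beta> c s - memory_kernel \<beta> c r"
    and "memory_kernel \<beta> c s - memory_kernel \<beta> c r \<le> memory_kernel_slope \<beta> c s * (s - r)"
proof -
  consider "r = s" | "r < s" using assms by linarith
  then have "memory_kernel_slope \<beta> c r * (s - r) \<le> memory_kernel \<beta> c s - memory_kernel \<beta> c r \<and>
      memory_kernel \<beta> c s - memory_kernel \<beta> c r \<le> memory_kernel_slope \<beta> c s * (s - r)"
  proof cases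
    case 2
    obtain y where y: "r < y" "y < s"
      "memory_kernel \<beta> c s - memory_kernel \<beta> c r = (s - r) * memory_kernel_slope \<beta> c y"
      using MVT2[OF 2, of "memory_kernel \<beta> c" "memory_kernel_slope \<beta> c"]
        memory_kernel_has_derivative assms by force
    have "memory_kernel_slope \<beta> c r \<le> memory_kernel_slope \<beta> c y"
      "memory_kernel_slope \<beta> c y \<le> memory_kernel_slope \<beta> c s"
      using y assms by (auto intro!: memory_kernel_slope_mono)
    then show ?thesis using y 2 by (auto simp: mult.commute intro!: mult_left_mono)
  qed simp
  then show "memory_kernel_slope \<beta> c r * (s - r) \<le> memory_kernel \<beta> c s - memory_kernel \<beta> c r"
    and "memory_kernel \<beta> c s - memory_kernel \<beta> c r \<le> memory_kernel_slope \<beta> c s * (s - r)"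
    by auto
qed

lemma memory_kernel_mono_on:
  assumes "0 < \<beta>" "\<beta> < 1" "b < c"
  shows "mono_on {a..b} (memory_kernel \<beta> c)"
proof (rule mono_onI)
  fix r s assume rs: "r \<in> {a..b}" "s \<in> {a..b}" "r \<le> s"
  have "0 \<le> memory_kernel_slope \<beta> c r * (s - r)"
    using rs assms by (intro mult_nonneg_nonneg memory_kernel_slope_nonneg) auto
  also have "\<dots> \<le> memory_kernel \<beta> c s - memory_kernel \<beta> c r"
    using rs assms by (intro memory_kernel_increment) auto
  finally show "memory_kernel \<beta> c r \<le> memory_kernel \<beta> c s" by simp
qed

lemma memory_kernel_integral_to_singularity:
  assumes "\<beta> < 1" "a < c"
  shows "integral {a..c} (memory_kernel \<beta> c) = (c - a) * memory_kernel \<beta> c a / (1 - \<beta>)"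
proof -
  let ?F = "\<lambda>s. - ((c - s) powr (1 - \<beta>)) / (1 - \<beta>) / Gamma (1 - \<beta>)"
  have Gamma: "Gamma (1 - \<beta>) \<noteq> 0" using assms by (simp add: Gamma_real_nonzero)
  have "(memory_kernel \<beta> c has_integral (?F c - ?F a)) {a..c}"
    \<comment> \<open>The derivative is only needed in the interior, so the singularity at \<open>c\<close> does no harm.\<close>
  proof (rule fundamental_theorem_of_calculus_interior)
    show "a \<le> c" using assms by simp
    show "continuous_on {a..c} ?F"
      using assms Gamma by (intro continuous_intros continuous_on_powr') auto
    fix s assume "s \<in> {a<..<c}"
    then have "(?F has_real_derivative memory_kernel \<beta> c s) (at s)"
      unfolding memory_kernel_def omega_def using assms Gamma
      by (auto intro!: derivative_eq_intros)
    then show "(?F has_vector_derivative memory_kernel \<beta> c s) (at s)"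
      by (simp add: has_real_derivative_iff_has_vector_derivative)
  qed
  then have "integral {a..c} (memory_kernel \<beta> c) =
      (c - a) powr (1 - \<beta>) / (1 - \<beta>) / Gamma (1 - \<beta>)"
    using assms by (simp add: integral_unique)
  also have "(c - a) powr (1 - \<beta>) = (c - a) * (c - a) powr (- \<beta>)"
    using assms powr_add[of "c - a" 1 "- \<beta>"] by simp
  finally show ?thesis
    unfolding memory_kernel_def[of \<beta> c a] omega_def by (simp add: mult_ac)
qed

section \<open>Bounds for the Alikhanov coefficients\<close>

text \<open>The coefficients are indexed by the number \<open>k\<close> of the mesh interval, so that their lower index
  is \<open>n - k\<close>.\<close>

text \<open>The points \<open>t 0, \<dots>, t n\<close> are strictly increasing; later values of \<open>t\<close> are arbitrary.\<close>

definition strict_mesh :: "nat \<Rightarrow> (nat \<Rightarrow> real) \<Rightarrow> bool" where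
  "strict_mesh n t \<longleftrightarrow> (\<forall>k<n. t k < t (k + 1))"

lemma mesh_mono:
  fixes t :: "nat \<Rightarrow> real"
  assumes "strict_mesh n t" "i \<le> j" "j \<le> n"
  shows "t i \<le> t j"
  using assms(2,3)
proof (induction j rule: dec_induct)
  case (step j)
  then show ?case using assms(1) unfolding strict_mesh_def
    by (metis Suc_eq_plus1 Suc_le_lessD less_imp_le order_trans)
qed simp

lemma step_pos:
  assumes "strict_mesh n t" "1 \<le> k" "k \<le> n"
  shows "0 < step t k"
proof -
  have "k - 1 < n" using assms by simp
  then have "t (k - 1) < t (k - 1 + 1)" using assms(1) unfolding strict_mesh_def by blast
  then show ?thesis using assms(2) by (simp add: step_def)
qed

lemma step_ratio_nonneg:
  assumes "strict_mesh n t" "1 \<le> k" "k < n"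
  shows "0 \<le> step_ratio t k"
  using step_pos[OF assms(1), of k] step_pos[OF assms(1), of "k + 1"] assms(2,3)
  by (simp add: step_ratio_def)

lemma offset_time:
  fixes t :: "nat \<Rightarrow> real"
  shows "offset \<theta> t n = t (n - 1) + (1 - \<theta>) * step t n"
  by (simp add: offset_def step_def algebra_simps)

lemma mesh_before_offset_time:
  fixes t :: "nat \<Rightarrow> real"
  assumes mesh: "strict_mesh n t" and "\<theta> < 1" "k < n"
  shows "t k < offset \<theta> t n"
proof -
  have "t k \<le> t (n - 1)" using assms by (intro mesh_mono[of n]) auto
  moreover have "0 < (1 - \<theta>) * step t n"
    using step_pos[OF mesh, of n] assms by (intro mult_pos_pos) auto
  ultimately show ?thesis by (simp add: offset_time)
qed

lemma alikhanov_a_eq: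
  assumes mesh: "strict_mesh n t" and "\<beta> < 1" "1 \<le> k" "k < n"
  shows "alikhanov_a \<beta> t n (n - k) =
    1 / step t k * integral {t (k - 1)..t k} (memory_kernel \<beta> (offset (\<beta> / 2) t n))"
proof -
  have "min (t k) (offset (\<beta> / 2) t n) = t k"
    using mesh_before_offset_time[OF mesh, where \<theta> = "\<beta> / 2" and k = k] assms by simp
  then show ?thesis
    using assms by (simp add: alikhanov_a_def Let_def memory_kernel_def[abs_def])
qed

text \<open>The offset time lies at distance \<open>(1 - \<beta> / 2) * step t n\<close> from \<open>t (n - 1)\<close>, and integrating the
  kernel up to its singularity produces a factor \<open>1 / (1 - \<beta>)\<close>.\<close>

lemma alikhanov_a_0_eq:
  assumes mesh: "strict_mesh n t" and "0 < \<beta>" "\<beta> < 1" "1 \<le> n"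
  shows "(1 - \<beta>) * alikhanov_a \<beta> t n 0 =
    (1 - \<beta> / 2) * memory_kernel \<beta> (offset (\<beta> / 2) t n) (t (n - 1))"
proof -
  let ?c = "offset (\<beta> / 2) t n"
  have pos: "0 < step t n" using step_pos[OF mesh, of n] assms by simp
  have "(1 - \<beta> / 2) * step t n \<le> 1 * step t n"
    using pos assms by (intro mult_right_mono) auto
  then have "?c \<le> t n" unfolding offset_time by (simp add: step_def)
  then have "alikhanov_a \<beta> t n 0 = 1 / step t n * integral {t (n - 1)..?c} (memory_kernel \<beta> ?c)"
    by (simp add: alikhanov_a_def Let_def memory_kernel_def[abs_def])
  also have "\<dots> = 1 / step t n * ((?c - t (n - 1)) * memory_kernel \<beta> ?c (t (n - 1)) / (1 - \<beta>))"
    using mesh_before_offset_time[OF mesh, where \<theta> = "\<beta> / 2" and k = "n - 1"] assms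
    by (subst memory_kernel_integral_to_singularity) auto
  also have "\<dots> = (1 - \<beta> / 2) * memory_kernel \<beta> ?c (t (n - 1)) / (1 - \<beta>)"
    using pos by (simp add: offset_time)
  finally show ?thesis using assms(3) by simp
qed

lemma alikhanov_b_eq:
  assumes "k \<le> n"
  shows "alikhanov_b \<beta> t n (n - k) = 2 / (step t k * (step t k + step t (k + 1))) *
    integral {t (k - 1)..t k}
      (\<lambda>s. memory_kernel \<beta> (offset (\<beta> / 2) t n) s * (s - (t (k - 1) + t k) / 2))"
  using assms by (simp add: alikhanov_b_def Let_def memory_kernel_def midpoint_time_def)

lemma alikhanov_b_nonneg:
  assumes mesh: "strict_mesh n t" and "0 < \<beta>" "\<beta> < 1" "1 \<le> k" "k < n"
  shows "0 \<le> alikhanov_b \<beta> t n (n - k)"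
proof -
  have "t k < offset (\<beta> / 2) t n"
    using mesh_before_offset_time[OF mesh, where \<theta> = "\<beta> / 2" and k = k] assms by simp
  then have "0 \<le> integral {t (k - 1)..t k}
      (\<lambda>s. memory_kernel \<beta> (offset (\<beta> / 2) t n) s * (s - (t (k - 1) + t k) / 2))"
    using mesh_mono[OF mesh, of "k - 1" k] assms
    by (intro centred_moment_nonneg memory_kernel_continuous_on memory_kernel_mono_on) auto
  then show ?thesis
    using step_pos[OF mesh, of k] step_pos[OF mesh, of "k + 1"] assms
    by (subst alikhanov_b_eq) auto
qed

lemma kernel_le_alikhanov_a_minus_b:
  assumes mesh: "strict_mesh n t" and "0 < \<beta>" "\<beta> < 1" "1 \<le> k" "k < n"
  shows "memory_kernel \<beta> (offset (\<beta> / 2) t n) (t (k - 1))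
    \<le> alikhanov_a \<beta> t n (n - k) - alikhanov_b \<beta> t n (n - k)"
proof -
  let ?c = "offset (\<beta> / 2) t n"
  have tk: "t k < ?c"
    using mesh_before_offset_time[OF mesh, where \<theta> = "\<beta> / 2" and k = k] assms by simp
  have "memory_kernel \<beta> ?c (t (k - 1)) \<le>
      1 / (t k - t (k - 1)) * integral {t (k - 1)..t k} (memory_kernel \<beta> ?c)
      - 2 / ((t k - t (k - 1)) * (t k - t (k - 1) + step t (k + 1))) *
        integral {t (k - 1)..t k} (\<lambda>s. memory_kernel \<beta> ?c s * (s - (t (k - 1) + t k) / 2))"
    using step_pos[OF mesh, of "k + 1"] step_pos[OF mesh, of k] tk assms
    by (intro mean_minus_centred_moment_ge memory_kernel_continuous_on memory_kernel_mono_on)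
       (auto simp: step_def)
  then show ?thesis
    using assms by (simp add: alikhanov_a_eq[OF mesh] alikhanov_b_eq step_def)
qed

text \<open>The slope \<open>D\<close> of the kernel at \<open>t (k - 1)\<close> bounds the slope from above on the interval to the
  left and from below on the interval to the right. With \<open>\<rho>\<close> the step ratio and \<open>h\<close> the step of
  the right interval, the left-hand side exceeds the mean \<open>a\<close> by at most
  \<open>D * h * \<rho>^3 / (6 * (1 + \<rho>))\<close>, while the right-hand side exceeds \<open>a\<close> by at least
  \<open>D * h / 2\<close>. The condition \<open>\<rho>^3 \<le> 3 * (1 + \<rho>)\<close> that remains holds for \<open>\<rho> \<le> 7 / 4\<close>.\<close>

lemma alikhanov_a_plus_ratio_b_le_kernel:
  assumes mesh: "strict_mesh n t" and "0 < \<beta>" "\<beta> < 1" "2 \<le> k" "k < n"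
    and ratio: "step_ratio t (k - 1) \<le> 7 / 4"
  shows "alikhanov_a \<beta> t n (n - k) + step_ratio t (k - 1) * alikhanov_b \<beta> t n (n - k + 1)
    \<le> memory_kernel \<beta> (offset (\<beta> / 2) t n) (t k)"
proof -
  define c where "c = offset (\<beta> / 2) t n"
  define D where "D = memory_kernel_slope \<beta> c (t (k - 1))"
  define h where "h = step t k"
  define \<rho> where "\<rho> = step_ratio t (k - 1)"
  have tk: "t (k - 1) < c" "t k < c"
    using mesh_before_offset_time[OF mesh, where \<theta> = "\<beta> / 2"] assms unfolding c_def by auto
  have h: "0 < h" and h': "0 < step t (k - 1)"
    using step_pos[OF mesh] assms unfolding h_def by auto
  have \<rho>: "0 < \<rho>" "\<rho> \<le> 7 / 4" and step_eq: "step t (k - 1) = \<rho> * h"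
    using ratio h h' assms by (auto simp: \<rho>_def step_ratio_def h_def)
  have D: "0 \<le> D" using assms by (simp add: D_def memory_kernel_slope_nonneg)
  have a: "alikhanov_a \<beta> t n (n - k) \<le> memory_kernel \<beta> c (t k) - D * h / 2"
  proof -
    have "1 / (t k - t (k - 1)) * integral {t (k - 1)..t k} (memory_kernel \<beta> c)
        \<le> memory_kernel \<beta> c (t k) - D * (t k - t (k - 1)) / 2"
    proof (rule mean_le_right_value)
      show "t (k - 1) < t k" using h by (simp add: h_def step_def)
      show "continuous_on {t (k - 1)..t k} (memory_kernel \<beta> c)"
        using assms tk by (intro memory_kernel_continuous_on) auto
      fix s assume s: "t (k - 1) \<le> s" "s \<le> t k"
      then have "D * (t k - s) \<le> memory_kernel_slope \<beta> c s * (t k - s)"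
        unfolding D_def using assms tk by (intro mult_right_mono memory_kernel_slope_mono) auto
      also have "\<dots> \<le> memory_kernel \<beta> c (t k) - memory_kernel \<beta> c s"
        using assms tk s by (intro memory_kernel_increment) auto
      finally show "D * (t k - s) \<le> memory_kernel \<beta> c (t k) - memory_kernel \<beta> c s" .
    qed
    then show ?thesis using assms by (simp add: alikhanov_a_eq[OF mesh] c_def h_def step_def)
  qed
  have b: "alikhanov_b \<beta> t n (n - k + 1) \<le> D * h * \<rho>\<^sup>2 / (6 * (1 + \<rho>))"
  proof -
    let ?l = "t (k - 2)" and ?r = "t (k - 1)"
    have r: "n - k + 1 = n - (k - 1)" "k - 1 - 1 = k - 2" "k - 1 + 1 = k" using assms by auto
    have len: "?r - ?l = \<rho> * h" using step_eq r(2) by (simp add: step_def)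
    have "integral {?l..?r} (\<lambda>s. memory_kernel \<beta> c s * (s - (?l + ?r) / 2))
        \<le> D * (?r - ?l) ^ 3 / 12"
    proof (rule centred_moment_le)
      show "?l \<le> ?r" using len mult_pos_pos[OF \<rho>(1) h] by linarith
      show "continuous_on {?l..?r} (memory_kernel \<beta> c)"
        using assms tk by (intro memory_kernel_continuous_on) auto
      fix p s assume ps: "?l \<le> p" "p \<le> s" "s \<le> ?r"
      then have "memory_kernel \<beta> c s - memory_kernel \<beta> c p \<le> memory_kernel_slope \<beta> c s * (s - p)"
        using assms tk by (intro memory_kernel_increment) auto
      also have "\<dots> \<le> D * (s - p)"
        unfolding D_def using assms tk ps by (intro mult_right_mono memory_kernel_slope_mono) auto
      finally show "memory_kernel \<beta> c s - memory_kernel \<beta> c p \<le> D * (s - p)" .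
    qed
    then have "2 / (\<rho> * h * (\<rho> * h + h)) *
        integral {?l..?r} (\<lambda>s. memory_kernel \<beta> c s * (s - (?l + ?r) / 2))
        \<le> 2 / (\<rho> * h * (\<rho> * h + h)) * (D * (\<rho> * h) ^ 3 / 12)"
      unfolding len using \<rho> h by (intro mult_left_mono) auto
    also have "\<dots> = 2 * D * (\<rho> * h) ^ 3 / (12 * (\<rho> * h) * (h * (1 + \<rho>)))"
      by (simp add: algebra_simps)
    also have "\<dots> = D * h * \<rho>\<^sup>2 / (6 * (1 + \<rho>))"
      using \<rho> h by (simp add: power2_eq_square power3_eq_cube divide_simps)
    finally show ?thesis
      using assms alikhanov_b_eq[of "k - 1" n \<beta> t]
      unfolding r step_eq by (simp add: c_def h_def)
  qed
  have "\<rho> * alikhanov_b \<beta> t n (n - k + 1) \<le> \<rho> * (D * h * \<rho>\<^sup>2 / (6 * (1 + \<rho>)))"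
    using b \<rho> by (intro mult_left_mono) auto
  also have "\<dots> = D * h * (\<rho> ^ 3 / (6 * (1 + \<rho>)))"
    by (simp add: power2_eq_square power3_eq_cube)
  also have "\<dots> \<le> D * h * (1 / 2)"
  proof (rule mult_left_mono)
    have "\<rho>\<^sup>2 \<le> (7 / 4)\<^sup>2" using \<rho> by (intro power_mono) auto
    then have "\<rho> ^ 3 \<le> \<rho> * (49 / 16)"
      unfolding power3_eq_cube mult.assoc using \<rho> by (intro mult_left_mono) (auto simp: power2_eq_square)
    also have "\<dots> \<le> 3 * (1 + \<rho>)" using \<rho> by simp
    finally have "\<rho> ^ 3 \<le> 3 * (1 + \<rho>)" .
    then show "\<rho> ^ 3 / (6 * (1 + \<rho>)) \<le> 1 / 2" using \<rho> by (simp add: divide_le_eq)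
  qed (use D h in simp)
  finally show ?thesis using a by (simp add: \<rho>_def c_def)
qed

lemma kernel_le_alikhanov_A:
  assumes mesh: "strict_mesh n t" and "0 < \<beta>" "\<beta> < 1" "1 \<le> k" "k < n"
  shows "memory_kernel \<beta> (offset (\<beta> / 2) t n) (t (k - 1)) \<le> alikhanov_A \<beta> t n (n - k)"
proof (cases "k = 1")
  case True
  then show ?thesis
    using kernel_le_alikhanov_a_minus_b[OF mesh, of \<beta> k] assms by (simp add: alikhanov_A_def)
next
  case False
  have "0 \<le> step_ratio t (k - 1) * alikhanov_b \<beta> t n (n - (k - 1))"
    using False assms
    by (intro mult_nonneg_nonneg step_ratio_nonneg[OF mesh] alikhanov_b_nonneg) auto
  moreover have "n - (k - 1) = n - k + 1" "n - (n - k) - 1 = k - 1" "n - k \<noteq> n - 1"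
    using False assms by auto
  ultimately show ?thesis
    using kernel_le_alikhanov_a_minus_b[OF mesh, of \<beta> k] assms
    by (simp add: alikhanov_A_def)
qed

lemma alikhanov_A_le_kernel:
  assumes mesh: "strict_mesh n t" and "0 < \<beta>" "\<beta> < 1" "1 \<le> k" "k < n"
    and ratio: "2 \<le> k \<Longrightarrow> step_ratio t (k - 1) \<le> 7 / 4"
  shows "alikhanov_A \<beta> t n (n - k) \<le> memory_kernel \<beta> (offset (\<beta> / 2) t n) (t k)"
proof (cases "k = 1")
  case True
  let ?c = "offset (\<beta> / 2) t n"
  have tk: "t k < ?c" and lt: "t (k - 1) < t k"
    using mesh_before_offset_time[OF mesh, where \<theta> = "\<beta> / 2" and k = k] step_pos[OF mesh, of k] assms
    by (auto simp: step_def)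
  have "1 / (t k - t (k - 1)) * integral {t (k - 1)..t k} (memory_kernel \<beta> ?c)
      \<le> memory_kernel \<beta> ?c (t k) - 0 * (t k - t (k - 1)) / 2"
    using lt tk assms
    by (intro mean_le_right_value memory_kernel_continuous_on)
       (auto intro: mono_onD[OF memory_kernel_mono_on[of \<beta> "t k" ?c "t (k - 1)"]])
  then have "alikhanov_a \<beta> t n (n - k) \<le> memory_kernel \<beta> ?c (t k)"
    using assms by (simp add: alikhanov_a_eq[OF mesh] step_def)
  then show ?thesis
    using alikhanov_b_nonneg[OF mesh, of \<beta> k] True assms by (simp add: alikhanov_A_def)
next
  case False
  have "n - (n - k) - 1 = k - 1" "n - k \<noteq> n - 1" using False assms by auto
  then show ?thesis
    using alikhanov_a_plus_ratio_b_le_kernel[OF mesh, of \<beta> k] False assms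
      alikhanov_b_nonneg[OF mesh, of \<beta> k]
    by (simp add: alikhanov_A_def)
qed

lemma kernel_le_alikhanov_A_0:
  assumes mesh: "strict_mesh n t" and "0 < \<beta>" "\<beta> < 1" "1 \<le> n"
  shows "(1 - \<beta> / 2) * memory_kernel \<beta> (offset (\<beta> / 2) t n) (t (n - 1))
    \<le> (1 - \<beta>) * alikhanov_A \<beta> t n 0"
proof -
  have "alikhanov_a \<beta> t n 0 \<le> alikhanov_A \<beta> t n 0"
  proof (cases "n = 1")
    case False
    have "0 \<le> step_ratio t (n - 1) * alikhanov_b \<beta> t n (n - (n - 1))"
      using False assms
      by (intro mult_nonneg_nonneg step_ratio_nonneg[OF mesh] alikhanov_b_nonneg) auto
    then show ?thesis using False assms by (simp add: alikhanov_A_def)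
  qed (simp add: alikhanov_A_def)
  then have "(1 - \<beta>) * alikhanov_a \<beta> t n 0 \<le> (1 - \<beta>) * alikhanov_A \<beta> t n 0"
    using assms by (intro mult_left_mono) auto
  then show ?thesis using alikhanov_a_0_eq[OF mesh, of \<beta>] assms by simp
qed

lemma alikhanov_A_nonneg:
  assumes mesh: "strict_mesh n t" and "0 < \<beta>" "\<beta> < 1" "1 \<le> k" "k \<le> n"
  shows "0 \<le> alikhanov_A \<beta> t n (n - k)"
proof (cases "k = n")
  case True
  have "0 \<le> (1 - \<beta> / 2) * memory_kernel \<beta> (offset (\<beta> / 2) t n) (t (n - 1))"
    using assms by (intro mult_nonneg_nonneg memory_kernel_nonneg) auto
  then have "0 \<le> (1 - \<beta>) * alikhanov_A \<beta> t n 0"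
    using kernel_le_alikhanov_A_0[OF mesh, of \<beta>] assms by linarith
  then show ?thesis using True assms(3) by (simp add: zero_le_mult_iff)
next
  case False
  then have "memory_kernel \<beta> (offset (\<beta> / 2) t n) (t (k - 1)) \<le> alikhanov_A \<beta> t n (n - k)"
    using assms by (intro kernel_le_alikhanov_A[OF mesh]) auto
  then show ?thesis
    using memory_kernel_nonneg[OF assms(3), of "offset (\<beta> / 2) t n" "t (k - 1)"] by linarith
qed

text \<open>The last coefficient dominates its predecessor by enough to compensate for the evaluation at the
  offset time instead of the last mesh point.\<close>

lemma alikhanov_A_last_pair:
  assumes mesh: "strict_mesh n t" and "0 < \<beta>" "\<beta> < 1" "2 \<le> n"
    and ratio: "\<And>k. 1 \<le> k \<Longrightarrow> k < n \<Longrightarrow> step_ratio t k \<le> 7 / 4"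
  shows "(1 - \<beta> / 2)\<^sup>2 * alikhanov_A \<beta> t n 1 \<le> (1 - \<beta>) * alikhanov_A \<beta> t n 0"
proof -
  let ?K = "memory_kernel \<beta> (offset (\<beta> / 2) t n) (t (n - 1))"
  have "alikhanov_A \<beta> t n (n - (n - 1)) \<le> ?K"
    using assms by (intro alikhanov_A_le_kernel[OF mesh]) auto
  then have "alikhanov_A \<beta> t n 1 \<le> ?K" using assms by simp
  then have "(1 - \<beta> / 2)\<^sup>2 * alikhanov_A \<beta> t n 1 \<le> (1 - \<beta> / 2)\<^sup>2 * ?K"
    by (intro mult_left_mono) auto
  also have "\<dots> \<le> (1 - \<beta> / 2) * ?K"
  proof (rule mult_right_mono[OF _ memory_kernel_nonneg])
    show "(1 - \<beta> / 2)\<^sup>2 \<le> 1 - \<beta> / 2"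
      using mult_left_mono[of "1 - \<beta> / 2" 1 "1 - \<beta> / 2"] assms by (simp add: power2_eq_square)
  qed (use assms in simp)
  also have "\<dots> \<le> (1 - \<beta>) * alikhanov_A \<beta> t n 0"
    using assms by (intro kernel_le_alikhanov_A_0[OF mesh]) auto
  finally show ?thesis .
qed

lemma alikhanov_A_mono:
  assumes mesh: "strict_mesh n t" and "0 < \<beta>" "\<beta> < 1" "1 \<le> k" "k < n"
    and ratio: "\<And>k. 1 \<le> k \<Longrightarrow> k < n \<Longrightarrow> step_ratio t k \<le> 7 / 4"
  shows "alikhanov_A \<beta> t n (n - k) \<le> alikhanov_A \<beta> t n (n - (k + 1))"
proof (cases "k + 1 = n")
  case True
  have nonneg: "0 \<le> alikhanov_A \<beta> t n (n - k)"
    using assms by (intro alikhanov_A_nonneg[OF mesh]) auto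
  \<comment> \<open>The factor \<open>(1 - \<beta> / 2)^2\<close> exceeds \<open>1 - \<beta>\<close>, so the bound for the last pair is stronger.\<close>
  have "1 - \<beta> \<le> (1 - \<beta> / 2)\<^sup>2" by (simp add: power2_eq_square algebra_simps)
  then have "(1 - \<beta>) * alikhanov_A \<beta> t n (n - k) \<le> (1 - \<beta> / 2)\<^sup>2 * alikhanov_A \<beta> t n (n - k)"
    using nonneg by (intro mult_right_mono)
  also have "\<dots> = (1 - \<beta> / 2)\<^sup>2 * alikhanov_A \<beta> t n 1"
    using True by auto
  also have "\<dots> \<le> (1 - \<beta>) * alikhanov_A \<beta> t n 0"
    using True assms by (intro alikhanov_A_last_pair[OF mesh]) auto
  finally show ?thesis using True assms(3) by (simp add: mult_le_cancel_left)
next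
  case False
  have "alikhanov_A \<beta> t n (n - k) \<le> memory_kernel \<beta> (offset (\<beta> / 2) t n) (t k)"
    using assms by (intro alikhanov_A_le_kernel[OF mesh]) auto
  also have "\<dots> \<le> alikhanov_A \<beta> t n (n - (k + 1))"
    using kernel_le_alikhanov_A[OF mesh, of \<beta> "k + 1"] False assms by simp
  finally show ?thesis .
qed

section \<open>Summation by parts\<close>

lemma abel_sum_lower_bound:
  fixes a u :: "nat \<Rightarrow> real"
  assumes "1 \<le> m" "0 \<le> a 1" and mono: "\<And>k. 1 \<le> k \<Longrightarrow> k < m \<Longrightarrow> a k \<le> a (k + 1)"
    and u: "\<And>k. k < m \<Longrightarrow> 0 \<le> u k"
  shows "- a m * u m \<le> (\<Sum>k=1..m. a k * (u (k - 1) - u k))"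
  using assms(1) mono u
proof (induction m rule: nat_induct_at_least)
  case base
  then show ?case using mult_nonneg_nonneg[OF assms(2), of "u 0"] by (simp add: right_diff_distrib)
next
  case (Suc m)
  have "a m * u m \<le> a (Suc m) * u m" using Suc by (intro mult_right_mono) auto
  moreover have "- a m * u m \<le> (\<Sum>k=1..m. a k * (u (k - 1) - u k))"
    using Suc by auto
  ultimately show ?case by (simp add: right_diff_distrib)
qed

text \<open>With \<open>w = (1 - \<theta>) * v n + \<theta> * v (n - 1)\<close> and \<open>u k = (w - v k)^2\<close> each summand is
  \<open>a k * (u (k - 1) - u k) / 2\<close>. Summation by parts over \<open>k < n\<close> leaves the last
  two values \<open>u (n - 1) = (1 - \<theta>)^2 * d^2\<close> and \<open>u n = \<theta>^2 * d^2\<close>, where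
  \<open>d = v n - v (n - 1)\<close>, and the hypothesis on \<open>a n\<close> and \<open>a (n - 1)\<close> absorbs them.\<close>

lemma offset_convexity_sum_nonneg:
  fixes a v :: "nat \<Rightarrow> real"
  assumes "1 \<le> n" "0 \<le> a 1" "\<theta> \<le> 1 / 2"
    and mono: "\<And>k. 1 \<le> k \<Longrightarrow> k + 1 < n \<Longrightarrow> a k \<le> a (k + 1)"
    and last: "2 \<le> n \<Longrightarrow> (1 - \<theta>)\<^sup>2 * a (n - 1) \<le> (1 - 2 * \<theta>) * a n"
  shows "0 \<le> (\<Sum>k=1..n. a k * ((v k - v (k - 1)) * (offset \<theta> v n - (v k + v (k - 1)) / 2)))"
proof -
  define w where "w = offset \<theta> v n"
  define u where "u k = (w - v k)\<^sup>2" for k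
  define d where "d = v n - v (n - 1)"
  have split: "(\<Sum>k=1..n. f k) = (\<Sum>k=1..n - 1. f k) + f n" for f :: "nat \<Rightarrow> real"
    using \<open>1 \<le> n\<close> by (cases n) auto
  have summand: "a k * ((v k - v (k - 1)) * (w - (v k + v (k - 1)) / 2))
      = a k * (u (k - 1) - u k) / 2" for k
    by (simp add: u_def power2_eq_square field_simps)
  have "w - v n = - \<theta> * d" "w - v (n - 1) = (1 - \<theta>) * d"
    by (simp_all add: w_def offset_def d_def algebra_simps)
  then have ends: "u n = \<theta>\<^sup>2 * d\<^sup>2" "u (n - 1) = (1 - \<theta>)\<^sup>2 * d\<^sup>2"
    by (simp_all add: u_def power_mult_distrib)
  have diff: "u (n - 1) - u n = (1 - 2 * \<theta>) * d\<^sup>2"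
    unfolding ends by (simp add: power2_eq_square algebra_simps)
  have "0 \<le> (\<Sum>k=1..n. a k * (u (k - 1) - u k))"
  proof (cases "n = 1")
    case True
    then show ?thesis using diff assms(2,3) by simp
  next
    case False
    have "- a (n - 1) * u (n - 1) \<le> (\<Sum>k=1..n - 1. a k * (u (k - 1) - u k))"
      using False assms by (intro abel_sum_lower_bound) (auto simp: u_def)
    moreover have "((1 - \<theta>)\<^sup>2 * a (n - 1)) * d\<^sup>2 \<le> ((1 - 2 * \<theta>) * a n) * d\<^sup>2"
      using last False assms(1) by (intro mult_right_mono) auto
    then have "a (n - 1) * u (n - 1) \<le> a n * (u (n - 1) - u n)"
      unfolding diff unfolding ends by (simp add: mult_ac)
    ultimately show ?thesis unfolding split by simp
  qed
  then have "0 \<le> (\<Sum>k=1..n. a k * (u (k - 1) - u k)) / 2" by simp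
  also have "\<dots> = (\<Sum>k=1..n. a k * ((v k - v (k - 1)) * (w - (v k + v (k - 1)) / 2)))"
    by (simp only: summand sum_divide_distrib)
  finally show ?thesis unfolding w_def .
qed

section \<open>The energy inequality\<close>

lemma inner_diag_mult_vector:
  fixes y z :: "real ^ 'm"
  shows "z \<bullet> (diag d *v y) = (\<Sum>i\<in>UNIV. d $ i * (z $ i * y $ i))"
proof -
  have "(diag d *v y) $ i = d $ i * y $ i" for i
    by (simp add: diag_def matrix_vector_mult_def if_distrib[of "\<lambda>x. x * _"] cong: if_cong)
  then show ?thesis by (simp add: inner_vec_def mult_ac)
qed

theorem lemma2p1:
  fixes \<beta> \<theta> T xl xr :: real
    and N :: nat
    and t :: "nat \<Rightarrow> real"
    and q :: "real \<Rightarrow> real \<Rightarrow> real"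
    and x :: "real ^ 'm"
    and z :: "nat \<Rightarrow> real ^ 'm"
  assumes beta: "0 < \<beta>" "\<beta> < 1"
    and theta: "\<theta> = \<beta> / 2"
    and T: "0 < T"
    and mesh: "t 0 = 0" "t N = T" "\<And>k. k < N \<Longrightarrow> t k < t (k + 1)"
    and ratios: "\<And>k. 1 \<le> k \<Longrightarrow> k < N \<Longrightarrow> step_ratio t k \<le> 7 / 4"
    and q_pos: "\<And>y s. y \<in> {xl<..<xr} \<Longrightarrow> s \<in> {0..T} \<Longrightarrow> 0 < q y s"
    and q_cont: "continuous_on ({xl<..<xr} \<times> {0..T}) (\<lambda>(y, s). q y s)"
    and nodes: "\<And>i. x $ i \<in> {xl<..<xr}"
  shows "(\<forall>n\<in>{1..N}.
            offset \<theta> z n \<bullet> (Qmat q x t n *v discrete_caputo \<beta> t z n)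
              \<ge> 1 / 2 * (\<Sum>k=1..n. alikhanov_A \<beta> t n (n - k) *
                            nabla (\<lambda>k. z k \<bullet> (Qmat q x t n *v z k)) k)) \<and>
         ((\<forall>y\<in>{xl<..<xr}. antimono_on {0..T} (q y)) \<longrightarrow>
          (\<forall>n\<in>{1..N}.
            offset \<theta> z n \<bullet> (Qmat q x t n *v discrete_caputo \<beta> t z n)
              \<ge> 1 / 2 * (\<Sum>k=1..n. alikhanov_A \<beta> t n (n - k) *
                            nabla (\<lambda>k. z k \<bullet> (Qmat q x t k *v z k)) k)))"
proof -
  define A where "A n k = alikhanov_A \<beta> t n (n - k)" for n k
  have strict: "strict_mesh n t" if "n \<le> N" for n
    using mesh(3) that by (simp add: strict_mesh_def)
  have A_nonneg: "0 \<le> A n k" if "n \<in> {1..N}" "1 \<le> k" "k \<le> n" for n k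
    unfolding A_def using that strict beta by (intro alikhanov_A_nonneg) auto
  have A_mono: "A n k \<le> A n (k + 1)" if "n \<in> {1..N}" "1 \<le> k" "k < n" for n k
    unfolding A_def using that strict beta ratios by (intro alikhanov_A_mono) auto
  have A_last: "(1 - \<theta>)\<^sup>2 * A n (n - 1) \<le> (1 - 2 * \<theta>) * A n n" if "n \<in> {1..N}" "2 \<le> n" for n
  proof -
    have "(1 - \<beta> / 2)\<^sup>2 * alikhanov_A \<beta> t n 1 \<le> (1 - \<beta>) * alikhanov_A \<beta> t n 0"
      using that strict beta ratios by (intro alikhanov_A_last_pair) auto
    then show ?thesis using that by (simp add: A_def theta)
  qed
  have time: "t k \<in> {0..T}" if "k \<le> N" for k
    using mesh_mono[OF strict, of N 0 k] mesh_mono[OF strict, of N k N] mesh that by auto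
  have pos: "0 \<le> q (x $ i) (t k)" if "k \<le> N" for i k
    using q_pos[OF nodes time[OF that]] by (rule less_imp_le)
  have lhs: "offset \<theta> z n \<bullet> (Qmat q x t n *v discrete_caputo \<beta> t z n) =
      (\<Sum>i\<in>UNIV. q (x $ i) (t n) *
        (\<Sum>k=1..n. A n k * ((z k $ i - z (k - 1) $ i) * offset \<theta> (\<lambda>k. z k $ i) n)))" for n
    unfolding Qmat_def inner_diag_mult_vector
    by (simp add: discrete_caputo_def nabla_def offset_def A_def sum_distrib_left mult_ac)
  have rhs: "1 / 2 * (\<Sum>k=1..n. alikhanov_A \<beta> t n (n - k) *
        nabla (\<lambda>k. z k \<bullet> (Qmat q x t (p k) *v z k)) k) =
      (\<Sum>i\<in>UNIV. 1 / 2 * (\<Sum>k=1..n. A n k *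
        (q (x $ i) (t (p k)) * (z k $ i)\<^sup>2 - q (x $ i) (t (p (k - 1))) * (z (k - 1) $ i)\<^sup>2)))" for n p
    unfolding Qmat_def inner_diag_mult_vector nabla_def A_def sum_distrib_left
      sum_subtractf[symmetric]
    by (subst sum.swap) (simp add: power2_eq_square)
  have fixed_weight: "1 / 2 * (\<Sum>k=1..n. alikhanov_A \<beta> t n (n - k) *
        nabla (\<lambda>k. z k \<bullet> (Qmat q x t n *v z k)) k)
      \<le> offset \<theta> z n \<bullet> (Qmat q x t n *v discrete_caputo \<beta> t z n)" if n: "n \<in> {1..N}" for n
    unfolding lhs rhs[where p = "\<lambda>_. n"]
  proof (rule sum_mono)
    fix i :: 'm
    let ?v = "\<lambda>k. z k $ i"
    have "0 \<le> (\<Sum>k=1..n. A n k *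
        ((?v k - ?v (k - 1)) * (offset \<theta> ?v n - (?v k + ?v (k - 1)) / 2)))"
      using n beta theta A_nonneg A_mono A_last by (intro offset_convexity_sum_nonneg) auto
    then have "0 \<le> q (x $ i) (t n) * (\<Sum>k=1..n. A n k *
        ((?v k - ?v (k - 1)) * (offset \<theta> ?v n - (?v k + ?v (k - 1)) / 2)))"
      using n pos by (intro mult_nonneg_nonneg) auto
    also have "\<dots> = q (x $ i) (t n) *
          (\<Sum>k=1..n. A n k * ((?v k - ?v (k - 1)) * offset \<theta> ?v n))
        - 1 / 2 * (\<Sum>k=1..n. A n k *
          (q (x $ i) (t n) * (?v k)\<^sup>2 - q (x $ i) (t n) * (?v (k - 1))\<^sup>2))"
      unfolding sum_distrib_left sum_subtractf[symmetric]
      by (intro sum.cong refl) (simp add: power2_eq_square field_simps)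
    finally show "1 / 2 * (\<Sum>k=1..n. A n k *
          (q (x $ i) (t n) * (?v k)\<^sup>2 - q (x $ i) (t n) * (?v (k - 1))\<^sup>2))
        \<le> q (x $ i) (t n) * (\<Sum>k=1..n. A n k * ((?v k - ?v (k - 1)) * offset \<theta> ?v n))"
      by simp
  qed
  have varying_weight: "1 / 2 * (\<Sum>k=1..n. alikhanov_A \<beta> t n (n - k) *
        nabla (\<lambda>k. z k \<bullet> (Qmat q x t k *v z k)) k)
      \<le> 1 / 2 * (\<Sum>k=1..n. alikhanov_A \<beta> t n (n - k) *
        nabla (\<lambda>k. z k \<bullet> (Qmat q x t n *v z k)) k)"
    if n: "n \<in> {1..N}" and anti: "\<forall>y\<in>{xl<..<xr}. antimono_on {0..T} (q y)" for n
    unfolding rhs[where p = "\<lambda>_. n"] rhs[where p = "\<lambda>k. k"]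
  proof (rule sum_mono)
    fix i :: 'm
    let ?v = "\<lambda>k. z k $ i"
    \<comment> \<open>The excess of the varying over the fixed weight: nonnegative, and zero at \<open>k = n\<close>.\<close>
    define u where "u k = (q (x $ i) (t k) - q (x $ i) (t n)) * (?v k)\<^sup>2" for k
    have "0 \<le> u k" if "k < n" for k
    proof -
      have "t k \<le> t n" using n that by (intro mesh_mono[OF strict[OF order_refl]]) auto
      then have "q (x $ i) (t n) \<le> q (x $ i) (t k)"
        using anti nodes[of i] time[of k] time[of n] n that
        by (auto simp: monotone_on_def)
      then show ?thesis by (simp add: u_def)
    qed
    then have "- A n n * u n \<le> (\<Sum>k=1..n. A n k * (u (k - 1) - u k))"
      using n A_nonneg A_mono by (intro abel_sum_lower_bound) auto
    also have "\<dots> = (\<Sum>k=1..n. A n k *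
          (q (x $ i) (t n) * (?v k)\<^sup>2 - q (x $ i) (t n) * (?v (k - 1))\<^sup>2))
        - (\<Sum>k=1..n. A n k *
          (q (x $ i) (t k) * (?v k)\<^sup>2 - q (x $ i) (t (k - 1)) * (?v (k - 1))\<^sup>2))"
      unfolding sum_subtractf[symmetric]
      by (intro sum.cong refl) (simp add: u_def algebra_simps)
    finally show "1 / 2 * (\<Sum>k=1..n. A n k *
          (q (x $ i) (t k) * (?v k)\<^sup>2 - q (x $ i) (t (k - 1)) * (?v (k - 1))\<^sup>2))
        \<le> 1 / 2 * (\<Sum>k=1..n. A n k *
          (q (x $ i) (t n) * (?v k)\<^sup>2 - q (x $ i) (t n) * (?v (k - 1))\<^sup>2))"
      by (simp add: u_def)
  qed
  show ?thesis
    using fixed_weight order_trans[OF varying_weight fixed_weight] by blast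
qed

end
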